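(* Let $(X,d)$ be an asymmetric metric space with forward FD-completion $(\overline X,\bar d)$. The natural inclusion map $\iota:X\to\overline X$ is an isometric embedding from $(X,d)$ to $(\overline X,\bar d)$, i.e. $\bar d(\iota(x),\iota(y))=d(x,y)$ for all $x,y\in X$. Moreover, $\iota(X)$ is forward dense in $\overline X$, meaning that every point in $\overline X$ is the forward limit of a sequence of points $(\iota(x_n))_{n\in\mathbb{N}}$ in $\iota(X)\subset\overline X$.
   Context: An asymmetric metric space is a set $X$ with $d:X\times X\to[0,\infty]$ such that $d(x,x)=0$; $d(x,y)=d(y,x)=0\Rightarrow x=y$; and $d(x,z)\le d(x,y)+d(y,z)$. A point $x$ is a forward limit of a sequence $(x_n)$ if $d(x_n,x)\to0$. A forward FD-sequence is a sequence $(x_n)$ with $\sum_{i=1}^\infty d(x_i,x_{i+1})<\infty$. An interlacing of $(x_i)$ and $(x'_j)$ is a sequence composed of terms of the two sequences such that the subsequence of terms from $(x_i)$ is infinite with strictly increasing indices, and likewise for the terms from $(x'_j)$. Two forward FD-sequences are forward FD-equivalent if they have an interlacing which is a forward FD-sequence; this is an equivalence relation. The forward FD-completion $\overline X$ is the set of equivalence classes of forward FD-sequences, equipped with the asymmetric metric $\bar d([x_n],[y_m])=\inf\liminf_{k\to\infty}d(x'_k,y'_k)$, the infimum over all forward FD-sequences $(x'_n)\in[x_n]$ and $(y'_m)\in[y_m]$. The natural inclusion $\iota:X\to\overline X$ sends $x$ to the class of the constant sequence $(x)_{n\in\mathbb{N}}$. *)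

theory Defs
  imports "HOL-Library.Extended_Nonnegative_Real"
begin

locale asym_metric_space =
  fixes X :: "'a set" and d :: "'a \<Rightarrow> 'a \<Rightarrow> ennreal"
  assumes refl: "x \<in> X \<Longrightarrow> d x x = 0"
    and separated: "x \<in> X \<Longrightarrow> y \<in> X \<Longrightarrow> d x y = 0 \<Longrightarrow> d y x = 0 \<Longrightarrow> x = y"
    and triangle: "x \<in> X \<Longrightarrow> y \<in> X \<Longrightarrow> z \<in> X \<Longrightarrow> d x z \<le> d x y + d y z"

definition forward_limit ::
  "'a set \<Rightarrow> ('a \<Rightarrow> 'a \<Rightarrow> ennreal) \<Rightarrow> (nat \<Rightarrow> 'a) \<Rightarrow> 'a \<Rightarrow> bool" where
  "forward_limit X d s x \<longleftrightarrow> range s \<subseteq> X \<and> x \<in> X \<and> (\<lambda>n. d (s n) x) \<longlonglongrightarrow> 0"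

definition forward_dense ::
  "'a set \<Rightarrow> ('a \<Rightarrow> 'a \<Rightarrow> ennreal) \<Rightarrow> 'a set \<Rightarrow> bool" where
  "forward_dense X d A \<longleftrightarrow>
     A \<subseteq> X \<and> (\<forall>x\<in>X. \<exists>s. range s \<subseteq> A \<and> forward_limit X d s x)"

definition isometric_embedding ::
  "'a set \<Rightarrow> ('a \<Rightarrow> 'a \<Rightarrow> ennreal) \<Rightarrow> 'b set \<Rightarrow> ('b \<Rightarrow> 'b \<Rightarrow> ennreal) \<Rightarrow> ('a \<Rightarrow> 'b) \<Rightarrow> bool" where
  "isometric_embedding X d Y e f \<longleftrightarrow>
     f ` X \<subseteq> Y \<and> (\<forall>x\<in>X. \<forall>y\<in>X. e (f x) (f y) = d x y)"

definition fd_seqs :: "'a set \<Rightarrow> ('a \<Rightarrow> 'a \<Rightarrow> ennreal) \<Rightarrow> (nat \<Rightarrow> 'a) set" where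
  "fd_seqs X d = {s. range s \<subseteq> X \<and> (\<Sum>i. d (s i) (s (Suc i))) < \<infinity>}"

text \<open>
  In \<open>interlacing s t u\<close>, \<open>p\<close> and \<open>q\<close> enumerate the positions of \<open>u\<close> holding terms of \<open>s\<close>
  and \<open>t\<close>, respectively, while \<open>a\<close> and \<open>b\<close> give the indices of those terms in \<open>s\<close> and \<open>t\<close>.
  Terms of \<open>s\<close> and \<open>t\<close> may be omitted.
\<close>
definition interlacing :: "(nat \<Rightarrow> 'a) \<Rightarrow> (nat \<Rightarrow> 'a) \<Rightarrow> (nat \<Rightarrow> 'a) \<Rightarrow> bool" where
  "interlacing s t u \<longleftrightarrow>
     (\<exists>(p :: nat \<Rightarrow> nat) (q :: nat \<Rightarrow> nat) (a :: nat \<Rightarrow> nat) (b :: nat \<Rightarrow> nat).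
        strict_mono p \<and> strict_mono q \<and> range p \<inter> range q = {} \<and> range p \<union> range q = UNIV \<and>
        strict_mono a \<and> strict_mono b \<and>
        (\<forall>k. u (p k) = s (a k)) \<and> (\<forall>k. u (q k) = t (b k)))"

definition fd_equiv ::
  "'a set \<Rightarrow> ('a \<Rightarrow> 'a \<Rightarrow> ennreal) \<Rightarrow> ((nat \<Rightarrow> 'a) \<times> (nat \<Rightarrow> 'a)) set" where
  "fd_equiv X d =
     {(s, t). s \<in> fd_seqs X d \<and> t \<in> fd_seqs X d \<and> (\<exists>u. interlacing s t u \<and> u \<in> fd_seqs X d)}"

definition fd_completion :: "'a set \<Rightarrow> ('a \<Rightarrow> 'a \<Rightarrow> ennreal) \<Rightarrow> (nat \<Rightarrow> 'a) set set" where
  "fd_completion X d = fd_seqs X d // fd_equiv X d"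

definition fd_dist ::
  "('a \<Rightarrow> 'a \<Rightarrow> ennreal) \<Rightarrow> (nat \<Rightarrow> 'a) set \<Rightarrow> (nat \<Rightarrow> 'a) set \<Rightarrow> ennreal" where
  "fd_dist d \<xi> \<eta> = (INF s\<in>\<xi>. INF t\<in>\<eta>. liminf (\<lambda>k. d (s k) (t k)))"

definition fd_incl :: "'a set \<Rightarrow> ('a \<Rightarrow> 'a \<Rightarrow> ennreal) \<Rightarrow> 'a \<Rightarrow> (nat \<Rightarrow> 'a) set" where
  "fd_incl X d x = fd_equiv X d `` {\<lambda>_. x}"

end

theory Submission
  imports Defs
begin

text \<open>
  The terms of an FD-sequence are forward Cauchy. If \<open>s\<close> is equivalent to the constant sequence
  \<open>x\<close>, then going back and forth along the interlacing shows that both \<open>d(s\<^sub>n, x)\<close> and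
  \<open>d(x, s\<^sub>n)\<close> tend to \<open>0\<close>; the triangle inequality then shows that no representatives of
  \<open>\<iota>(x)\<close>, \<open>\<iota>(y)\<close> do better than the constant ones. For density, \<open>\<iota>(s\<^sub>n)\<close> converges to
  the class of \<open>s\<close>, as seen from the representatives \<open>s\<^sub>n\<close> (constant) and \<open>s\<close>.
\<close>

text \<open>The tail is the total minus a partial sum. Finiteness of the total makes both the
  cancellation and the passage to the limit in this \<open>ennreal\<close> subtraction
  legitimate.\<close>

lemma ennreal_suminf_tail_tendsto_0:
  fixes f :: "nat \<Rightarrow> ennreal"
  assumes "(\<Sum>i. f i) < \<infinity>"
  shows "(\<lambda>n. \<Sum>i. f (i + n)) \<longlonglongrightarrow> 0"
proof -
  have "(\<lambda>n. (\<Sum>i. f i) - (\<Sum>i<n. f i)) \<longlonglongrightarrow> (\<Sum>i. f i) - (\<Sum>i. f i)"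
    using assms by (intro tendsto_diff_ennreal tendsto_const summable_LIMSEQ) auto
  moreover have "(\<Sum>i. f i) - (\<Sum>i<n. f i) = (\<Sum>i. f (i + n))" for n
  proof -
    have eq: "(\<Sum>i. f i) = (\<Sum>i. f (i + n)) + (\<Sum>i<n. f i)"
      by (rule suminf_offset) simp
    then have "(\<Sum>i<n. f i) \<noteq> top"
      using assms by (metis ennreal_add_eq_top infinity_ennreal_def less_irrefl)
    then show ?thesis
      unfolding eq by (rule ennreal_add_diff_cancel_right)
  qed
  ultimately show ?thesis
    using assms by simp
qed

text \<open>Even positions go to the first copy of \<open>s\<close> and odd ones to the second; each
  term keeps its own index, so \<open>a = p\<close> and \<open>b = q\<close>.\<close>

lemma interlacing_self: "interlacing s s s"
proof -
  have "range (\<lambda>k. 2 * k :: nat) \<inter> range (\<lambda>k. Suc (2 * k)) = {}"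
    by (auto; presburger)
  moreover have "range (\<lambda>k. 2 * k :: nat) \<union> range (\<lambda>k. Suc (2 * k)) = UNIV"
    by (auto simp: image_iff; presburger)
  moreover have "strict_mono (\<lambda>k. 2 * k :: nat)" "strict_mono (\<lambda>k. Suc (2 * k))"
    by (auto simp: strict_mono_def)
  ultimately show ?thesis
    unfolding interlacing_def by blast
qed

lemma fd_equiv_self: "s \<in> fd_seqs X d \<Longrightarrow> (s, s) \<in> fd_equiv X d"
  using interlacing_self by (auto simp: fd_equiv_def)

lemma fd_dist_le_liminf:
  assumes "s \<in> \<xi>" "t \<in> \<eta>"
  shows "fd_dist d \<xi> \<eta> \<le> liminf (\<lambda>k. d (s k) (t k))"
  unfolding fd_dist_def using assms by (meson INF_lower2 order_refl)

context asym_metric_space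
begin

lemma const_in_fd_seqs: "x \<in> X \<Longrightarrow> (\<lambda>_. x) \<in> fd_seqs X d"
  by (auto simp: fd_seqs_def refl)

lemma fd_incl_in_completion: "x \<in> X \<Longrightarrow> fd_incl X d x \<in> fd_completion X d"
  unfolding fd_incl_def fd_completion_def by (intro quotientI const_in_fd_seqs)

lemma const_in_fd_incl: "x \<in> X \<Longrightarrow> (\<lambda>_. x) \<in> fd_incl X d x"
  by (simp add: fd_incl_def fd_equiv_self const_in_fd_seqs)

text \<open>The bound does not depend on \<open>m\<close>. It therefore yields both the forward
  Cauchy property and, with \<open>n\<close> fixed and \<open>m\<close> growing, the estimate behind
  density.\<close>

lemma dist_le_tail:
  assumes s: "range s \<subseteq> X" and "n \<le> m"
  shows "d (s n) (s m) \<le> (\<Sum>i. d (s (i + n)) (s (Suc (i + n))))"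
proof -
  have sX: "s i \<in> X" for i
    using s by auto
  have "d (s n) (s (k + n)) \<le> (\<Sum>i<k. d (s (i + n)) (s (Suc (i + n))))" for k
  proof (induction k)
    case 0
    then show ?case by (simp add: refl sX)
  next
    case (Suc k)
    have "d (s n) (s (Suc k + n)) \<le> d (s n) (s (k + n)) + d (s (k + n)) (s (Suc (k + n)))"
      using triangle[OF sX sX sX] by simp
    with Suc show ?case
      by (auto intro: order_trans add_right_mono)
  qed
  from this[of "m - n"] have "d (s n) (s m) \<le> (\<Sum>i<m-n. d (s (i + n)) (s (Suc (i + n))))"
    using \<open>n \<le> m\<close> by simp
  also have "\<dots> \<le> (\<Sum>i. d (s (i + n)) (s (Suc (i + n))))"
    by (intro sum_le_suminf) auto
  finally show ?thesis .
qed

lemma fd_seq_tail_tendsto_0: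
  "s \<in> fd_seqs X d \<Longrightarrow> (\<lambda>n. \<Sum>i. d (s (i + n)) (s (Suc (i + n)))) \<longlonglongrightarrow> 0"
  using ennreal_suminf_tail_tendsto_0[of "\<lambda>i. d (s i) (s (Suc i))"] by (simp add: fd_seqs_def)

lemma fd_seq_forward_Cauchy:
  assumes s: "s \<in> fd_seqs X d" and "e > 0"
  obtains N where "\<And>n m. N \<le> n \<Longrightarrow> n \<le> m \<Longrightarrow> d (s n) (s m) < e"
proof -
  obtain N where "\<And>n. N \<le> n \<Longrightarrow> (\<Sum>i. d (s (i + n)) (s (Suc (i + n)))) < e"
    using order_tendstoD(2)[OF fd_seq_tail_tendsto_0[OF s] \<open>e > 0\<close>]
    by (auto simp: eventually_sequentially)
  moreover have "range s \<subseteq> X"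
    using s by (simp add: fd_seqs_def)
  ultimately show ?thesis
    using that dist_le_tail by (meson le_less_trans)
qed

text \<open>Terms equal to \<open>x\<close> and terms of \<open>s\<close> both occur arbitrarily
  late in the interlacing \<open>u\<close>, so the Cauchy property of \<open>u\<close> compares them
  in either order. One \<open>e\<close> is spent on such a jump inside \<open>u\<close>, the other
  on a move inside \<open>s\<close>.\<close>

lemma fd_equiv_const_eventually_close:
  assumes s: "(\<lambda>_. x, s) \<in> fd_equiv X d" and "e > 0"
  shows "\<forall>\<^sub>F n in sequentially. d (s n) x \<le> e + e \<and> d x (s n) \<le> e + e"
proof -
  obtain u where sf: "s \<in> fd_seqs X d" and uf: "u \<in> fd_seqs X d" and xf: "(\<lambda>_. x) \<in> fd_seqs X d"
    and "interlacing (\<lambda>_. x) s u"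
    using s by (auto simp: fd_equiv_def)
  then obtain p q b :: "nat \<Rightarrow> nat" where "strict_mono p" "strict_mono q" "strict_mono b"
    and up: "\<And>k. u (p k) = x" and uq: "\<And>k. u (q k) = s (b k)"
    unfolding interlacing_def by blast
  then have ge: "k \<le> p k" "k \<le> q k" "k \<le> b k" for k
    by (auto intro: strict_mono_imp_increasing)
  have X: "x \<in> X" "s k \<in> X" for k
    using sf xf by (auto simp: fd_seqs_def)
  obtain M where M: "\<And>n m. M \<le> n \<Longrightarrow> n \<le> m \<Longrightarrow> d (s n) (s m) < e"
    using fd_seq_forward_Cauchy[OF sf \<open>e > 0\<close>] by blast
  obtain N where N: "\<And>n m. N \<le> n \<Longrightarrow> n \<le> m \<Longrightarrow> d (u n) (u m) < e"
    using fd_seq_forward_Cauchy[OF uf \<open>e > 0\<close>] by blast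
  \<comment> \<open>\<open>l\<close> is the position in \<open>u\<close> of an \<open>x\<close>
    lying beyond \<open>N\<close>. Since \<open>l \<le> q l\<close>, the term \<open>s (b l)\<close>
    comes no earlier in \<open>u\<close>, and \<open>M \<le> l \<le> b l\<close> allows moving on
    from it inside \<open>s\<close>.\<close>
  define l where "l = p (max M N)"
  have l: "max M N \<le> l"
    using ge(1) unfolding l_def .
  have to: "d (s n) x \<le> e + e" if "M \<le> n" for n
  proof -
    \<comment> \<open>The route is from \<open>s n\<close> forward to \<open>s (b k)\<close>, which
      is \<open>u (q k)\<close>, and from there forward in \<open>u\<close> to the later
      \<open>x\<close> at position \<open>p (q k)\<close>.\<close>
    define k where "k = max n N"
    have "d (s n) (s (b k)) < e"
      using ge(3)[of k] that by (intro M) (auto simp: k_def)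
    moreover have "d (u (q k)) (u (p (q k))) < e"
      using ge(1)[of "q k"] ge(2)[of k] by (intro N) (auto simp: k_def)
    ultimately show ?thesis
      using triangle[OF X(2) X(2) X(1), of n "b k"]
      unfolding up uq by (meson add_mono less_imp_le order_trans)
  qed
  have "d x (s n) \<le> e + e" if "b l \<le> n" for n
  proof -
    have "d (u (p (max M N))) (u (q l)) < e"
      using ge(1)[of "max M N"] ge(2)[of l] by (intro N) (auto simp: l_def)
    moreover have "d (s (b l)) (s n) < e"
      using ge(3)[of l] l that by (intro M) auto
    ultimately show ?thesis
      using triangle[OF X(1) X(2) X(2), of n "b l"]
      unfolding up uq by (meson add_mono less_imp_le order_trans)
  qed
  with to show ?thesis
    by (auto simp: eventually_sequentially intro!: exI[of _ "max M (b l)"])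
qed

lemma fd_equiv_const_tendsto_0:
  assumes "(\<lambda>_. x, s) \<in> fd_equiv X d"
  shows "(\<lambda>n. d (s n) x) \<longlonglongrightarrow> 0" and "(\<lambda>n. d x (s n)) \<longlonglongrightarrow> 0"
proof -
  have "\<forall>\<^sub>F n in sequentially. d (s n) x < e \<and> d x (s n) < e" if "0 < e" for e
  proof -
    \<comment> \<open>The previous lemma gives only \<open>\<le>\<close>; applying it with
      \<open>r / 2\<close> for some \<open>r < e\<close> restores the strict bound.\<close>
    obtain r where r: "0 < r" "r < e"
      using \<open>0 < e\<close> dense by blast
    have "r / 2 + r / 2 = r * 2 / 2"
      by (simp add: add_divide_distrib_ennreal mult_2_right)
    also have "\<dots> = r"
      by (rule ennreal_mult_divide_eq) auto
    finally have half: "r / 2 > 0" "r / 2 + r / 2 = r"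
      using r by (auto simp: ennreal_zero_less_divide)
    show ?thesis
      using fd_equiv_const_eventually_close[OF assms half(1)] r(2) unfolding half(2)
      by (auto elim!: eventually_mono)
  qed
  then show "(\<lambda>n. d (s n) x) \<longlonglongrightarrow> 0" "(\<lambda>n. d x (s n)) \<longlonglongrightarrow> 0"
    by (auto intro!: order_tendstoI simp: eventually_conj_iff)
qed

text \<open>The path \<open>x\<close>, \<open>s k\<close>, \<open>t k\<close>, \<open>y\<close>
  bounds \<open>d x y\<close> by \<open>d (s k) (t k)\<close> plus two errors. The error at
  \<open>x\<close> is directed away from \<open>x\<close> and the one at \<open>y\<close> towards
  \<open>y\<close>, and both vanish by equivalence with the constants.\<close>

lemma dist_le_liminf:
  assumes x: "x \<in> X" and y: "y \<in> X"
    and s: "(\<lambda>_. x, s) \<in> fd_equiv X d" and t: "(\<lambda>_. y, t) \<in> fd_equiv X d"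
  shows "d x y \<le> liminf (\<lambda>k. d (s k) (t k))"
proof -
  have X: "s k \<in> X" "t k \<in> X" for k
    using s t by (auto simp: fd_equiv_def fd_seqs_def)
  have le: "d x y \<le> (d x (s k) + d (t k) y) + d (s k) (t k)" for k
    using triangle[OF x X(1) y, of k] triangle[OF X(1) X(2) y, of k k]
    by (metis (no_types, opaque_lifting) add.assoc add.commute add_left_mono order_trans)
  have lim: "(\<lambda>k. d x (s k) + d (t k) y) \<longlonglongrightarrow> 0"
    using tendsto_add[OF fd_equiv_const_tendsto_0(2)[OF s] fd_equiv_const_tendsto_0(1)[OF t]]
    by simp
  show ?thesis
  \<comment> \<open>Replacing the error by a constant \<open>e\<close> lets it be pulled out of the
    liminf.\<close>
  proof (rule ennreal_le_epsilon)
    fix e :: real assume "0 < e"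
    then have "\<forall>\<^sub>F k in sequentially. d x (s k) + d (t k) y < ennreal e"
      by (intro order_tendstoD(2)[OF lim]) simp
    then have "\<forall>\<^sub>F k in sequentially. d x y \<le> d (s k) (t k) + ennreal e"
      by eventually_elim (metis le add.commute add_left_mono less_imp_le order_trans)
    then have "d x y \<le> liminf (\<lambda>k. d (s k) (t k) + ennreal e)"
      by (rule Liminf_bounded)
    then show "d x y \<le> liminf (\<lambda>k. d (s k) (t k)) + ennreal e"
      by (simp add: Liminf_add_const)
  qed
qed

lemma fd_dist_fd_incl:
  assumes "x \<in> X" "y \<in> X"
  shows "fd_dist d (fd_incl X d x) (fd_incl X d y) = d x y"
proof (rule antisym)
  show "fd_dist d (fd_incl X d x) (fd_incl X d y) \<le> d x y"
    using fd_dist_le_liminf[OF const_in_fd_incl const_in_fd_incl, of x y d] assms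
    by (simp add: Liminf_const)
  show "d x y \<le> fd_dist d (fd_incl X d x) (fd_incl X d y)"
    unfolding fd_dist_def using assms
    by (intro INF_greatest dist_le_liminf) (auto simp: fd_incl_def)
qed

lemma fd_incl_terms_forward_limit:
  assumes s: "s \<in> fd_seqs X d"
  shows "forward_limit (fd_completion X d) (fd_dist d) (\<lambda>n. fd_incl X d (s n)) (fd_equiv X d `` {s})"
proof -
  have sX: "range s \<subseteq> X"
    using s by (simp add: fd_seqs_def)
  have "fd_dist d (fd_incl X d (s n)) (fd_equiv X d `` {s}) \<le> (\<Sum>i. d (s (i + n)) (s (Suc (i + n))))"
    for n
  proof -
    have "fd_dist d (fd_incl X d (s n)) (fd_equiv X d `` {s}) \<le> liminf (\<lambda>k. d (s n) (s k))"
      using fd_dist_le_liminf[of "\<lambda>_. s n" _ s] const_in_fd_incl[of "s n"] fd_equiv_self[OF s] sX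
      by (simp add: image_subset_iff)
    \<comment> \<open>The tail bound holds only for \<open>n \<le> k\<close>, which suffices because
      a liminf ignores finitely many \<open>k\<close>.\<close>
    also have "\<dots> \<le> (\<Sum>i. d (s (i + n)) (s (Suc (i + n))))"
      by (rule Liminf_le) (auto simp: eventually_sequentially intro: dist_le_tail[OF sX])
    finally show ?thesis .
  qed
  then have "(\<lambda>n. fd_dist d (fd_incl X d (s n)) (fd_equiv X d `` {s})) \<longlonglongrightarrow> 0"
    by (intro tendsto_sandwich[OF _ _ tendsto_const fd_seq_tail_tendsto_0[OF s]]) auto
  then show ?thesis
    using sX s fd_incl_in_completion
    by (auto simp: forward_limit_def fd_completion_def intro: quotientI)
qed

end

theorem propositionB4:
  fixes X :: "'a set" and d :: "'a \<Rightarrow> 'a \<Rightarrow> ennreal"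
  assumes "asym_metric_space X d"
  shows "isometric_embedding X d (fd_completion X d) (fd_dist d) (fd_incl X d) \<and>
         forward_dense (fd_completion X d) (fd_dist d) (fd_incl X d ` X)"
proof -
  interpret asym_metric_space X d by fact
  have "\<exists>t. range t \<subseteq> fd_incl X d ` X \<and> forward_limit (fd_completion X d) (fd_dist d) t \<xi>"
    if \<xi>: "\<xi> \<in> fd_completion X d" for \<xi>
  proof -
    obtain s where "s \<in> fd_seqs X d" "\<xi> = fd_equiv X d `` {s}"
      using \<xi> by (auto simp: fd_completion_def elim: quotientE)
    then show ?thesis
      using fd_incl_terms_forward_limit
      by (intro exI[of _ "\<lambda>n. fd_incl X d (s n)"]) (auto simp: fd_seqs_def)
  qed
  then show ?thesis
    unfolding isometric_embedding_def forward_dense_def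
    using fd_incl_in_completion fd_dist_fd_incl by blast
qed

end
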